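(* Let $c_F,c_S>0$ and let $p,q\in\mathbb{N}$ be without common factors. For every $n\in\mathbb{N}$ let $D^{\rm w}_n=\{w_1,\dots,w_n\}\subset\partial\mathcal{L}_{FS}$ be any configuration of $n$ atoms such that, if $q=1$, $$w_{i+1}=w_i+\boldsymbol t_1\qquad\text{for every } i=1,\dots,n-1. \tag{$*$}$$ Then $D^{\rm w}_n$ satisfies the following two assertions for every $n\in\mathbb{N}$: (i) $V_n(D^{\rm w}_n)=\min_{D_n\in\mathcal{C}_n}V_n(D_n)$; (ii) $V_n(D^{\rm w}_n)<V_n(D_n)$ for every crystalline configuration $D_n\in\mathcal{C}_n$ with $D_n\setminus\partial\mathcal{L}_{FS}\neq\emptyset$ (and, in the case $q=1$, also for every configuration $D_n\in\mathcal{C}_n$ with $D_n\setminus\partial\mathcal{L}_{FS}=\emptyset$ whose elements cannot be labelled $w_1,\dots,w_n$ so that $( * )$ holds); if and only if $$\begin{cases} c_S\ge 6c_F & \text{if } q\neq 1,\\ c_S\ge 4c_F & \text{if } q=1.\end{cases}\tag{$**$}$$ In particular, for the necessity of $( ** )$ assertion (i) is enough, and more specifically it is enough that there exists an increasing sequence $(n_k)_{k\in\mathbb{N}}$ such that $V_{n_k}(D^{\rm w}_{n_k})=\min_{D\in\mathcal{C}_{n_k}}V_{n_k}(D)$ for every $k$.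
   Context: Lattices. Let $e_S:=q/p$ with $p,q\in\mathbb{N}$ without common factors, $S:=\mathbb{R}\times\{r\in\mathbb{R}: r<0\}$, $\boldsymbol t_1:=(1,0)$, $\boldsymbol t_2:=\frac12(1,\sqrt3)$, $\boldsymbol t_3:=(0,1)$, $x_F:=(0,e_S)$. The substrate lattice $\mathcal{L}_S\subset\overline S$ is a fixed lattice, fully occupied by substrate atoms, with $\partial\mathcal{L}_S:=\mathcal{L}_S\cap(\mathbb{R}\times\{0\})=\{(ke_S,0):k\in\mathbb{Z}\}$. The film lattice is $\mathcal{L}_F:=\{x_F+k_1\boldsymbol t_1+k_2\boldsymbol t_2: k_1\in\mathbb{Z},\,k_2\in\mathbb{N}\cup\{0\}\}$, with $\partial\mathcal{L}_F:=\{x_F+k_1\boldsymbol t_1:k_1\in\mathbb{Z}\}$ and $\partial\mathcal{L}_{FS}:=\partial\mathcal{L}_F\cap(\partial\mathcal{L}_S+e_S\boldsymbol t_3)$. Crystalline configurations with $n$ atoms: $\mathcal{C}_n:=\{D\subset\mathcal{L}_F:\#D=n\}$. Energy. Let $c_F,c_S>0$ and $e_F:=1$. For $\alpha\in\{F,S\}$ let $v_{F\alpha}(r):=+\infty$ if $r<e_\alpha$, $v_{F\alpha}(r):=-c_\alpha$ if $r=e_\alpha$, and $v_{F\alpha}(r):=0$ if $r>e_\alpha$. Let $v^1(x):=\sum_{s\in\mathcal{L}_S}v_{FS}(|x-s|)$; for $x\in\mathcal{L}_F$ one has $v^1(x)=-c_S$ if $x\in\partial\mathcal{L}_{FS}$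 and $v^1(x)=0$ otherwise. For $D_n=\{x_1,\dots,x_n\}\in\mathcal{C}_n$, $$V_n(D_n):=\sum_{i\ne j}v_{FF}(|x_i-x_j|)+\sum_{i=1}^n v^1(x_i),$$ where the first sum runs over ordered pairs $(i,j)$ with $i\neq j$. *)

theory Defs
  imports "HOL-Analysis.Analysis"
begin

type_synonym point = "real \<times> real"

definition t1 :: point where "t1 = (1, 0)"
definition t2 :: point where "t2 = (1/2) *\<^sub>R (1, sqrt 3)"
definition t3 :: point where "t3 = (0, 1)"

definition substrate_half_plane :: "point set" where
  "substrate_half_plane = UNIV \<times> {r. r < 0}"

(* Throughout, eS is the substrate spacing q/p; the film spacing is 1. *)

definition substrate_boundary :: "point set \<Rightarrow> point set" where
  "substrate_boundary LS = LS \<inter> (UNIV \<times> {0})"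

(* Only the top layer of the substrate is prescribed. Nothing is assumed about how LS continues
   below it, so every reading of "lattice" (Bravais, multilattice, ...) is covered. *)
definition substrate_lattice :: "real \<Rightarrow> point set \<Rightarrow> bool" where
  "substrate_lattice eS LS \<longleftrightarrow>
     LS \<subseteq> closure substrate_half_plane \<and>
     substrate_boundary LS = {(of_int k * eS, 0) | k :: int. True}"

definition film_origin :: "real \<Rightarrow> point" where "film_origin eS = (0, eS)"

definition film_lattice :: "real \<Rightarrow> point set" where
  "film_lattice eS =
     {film_origin eS + of_int k1 *\<^sub>R t1 + of_nat k2 *\<^sub>R t2 | (k1 :: int) (k2 :: nat). True}"

definition film_boundary :: "real \<Rightarrow> point set" where
  "film_boundary eS = {film_origin eS + of_int k1 *\<^sub>R t1 | k1 :: int. True}"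

definition contact_sites :: "real \<Rightarrow> point set \<Rightarrow> point set" where
  "contact_sites eS LS = film_boundary eS \<inter> (\<lambda>s. s + eS *\<^sub>R t3) ` substrate_boundary LS"

definition configurations :: "real \<Rightarrow> nat \<Rightarrow> point set set" where
  "configurations eS n = {D. D \<subseteq> film_lattice eS \<and> finite D \<and> card D = n}"

(* Sticky-disc potential with equilibrium distance e and bond strength c. *)
definition sticky_disc :: "real \<Rightarrow> real \<Rightarrow> real \<Rightarrow> ereal" where
  "sticky_disc e c r = (if r < e then \<infinity> else if r = e then ereal (- c) else 0)"

(* The sum over the infinite set LS is taken in ereal. At every film site at most one summand is
   nonzero, so there it is a finite sum. *)
definition substrate_potential :: "real \<Rightarrow> real \<Rightarrow> point set \<Rightarrow> point \<Rightarrow> ereal" where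
  "substrate_potential eS cS LS x = (\<Sum>\<^sub>\<infinity>s\<in>LS. sticky_disc eS cS (norm (x - s)))"

(* The first sum runs over ordered pairs, so every bond is counted twice. *)
definition energy :: "real \<Rightarrow> real \<Rightarrow> real \<Rightarrow> point set \<Rightarrow> point set \<Rightarrow> ereal" where
  "energy eS cF cS LS D =
     (\<Sum>(x, y) \<in> {(x, y). x \<in> D \<and> y \<in> D \<and> x \<noteq> y}. sticky_disc 1 cF (norm (x - y)))
     + (\<Sum>x\<in>D. substrate_potential eS cS LS x)"

definition consecutive :: "nat \<Rightarrow> point set \<Rightarrow> bool" where
  "consecutive n D \<longleftrightarrow>
     (\<exists>w. bij_betw w {1..n} D \<and> (\<forall>i\<in>{1..<n}. w (i + 1) = w i + t1))"

definition wetting_configuration :: "nat \<Rightarrow> real \<Rightarrow> point set \<Rightarrow> nat \<Rightarrow> point set \<Rightarrow> bool" where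
  "wetting_configuration q eS LS n D \<longleftrightarrow>
     D \<subseteq> contact_sites eS LS \<and> finite D \<and> card D = n \<and> (q = 1 \<longrightarrow> consecutive n D)"

definition minimizes_energy ::
  "real \<Rightarrow> real \<Rightarrow> real \<Rightarrow> point set \<Rightarrow> nat \<Rightarrow> point set \<Rightarrow> bool" where
  "minimizes_energy eS cF cS LS n D \<longleftrightarrow>
     is_arg_min (energy eS cF cS LS) (\<lambda>E. E \<in> configurations eS n) D"

definition strictly_beats_nonwetting ::
  "nat \<Rightarrow> real \<Rightarrow> real \<Rightarrow> real \<Rightarrow> point set \<Rightarrow> nat \<Rightarrow> point set \<Rightarrow> bool" where
  "strictly_beats_nonwetting q eS cF cS LS n D \<longleftrightarrow>
     (\<forall>E\<in>configurations eS n. E - contact_sites eS LS \<noteq> {} \<longrightarrow>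
        energy eS cF cS LS D < energy eS cF cS LS E) \<and>
     (q = 1 \<longrightarrow>
        (\<forall>E\<in>configurations eS n. E - contact_sites eS LS = {} \<and> \<not> consecutive n E \<longrightarrow>
           energy eS cF cS LS D < energy eS cF cS LS E))"

definition wetting_threshold :: "nat \<Rightarrow> real \<Rightarrow> real \<Rightarrow> bool" where
  "wetting_threshold q cF cS \<longleftrightarrow> (if q = 1 then cS \<ge> 4 * cF else cS \<ge> 6 * cF)"

end

theory Submission
  imports Defs
begin

text \<open>
  Index the film site \<open>x\<^sub>F + i t\<^sub>1 + j t\<^sub>2\<close> by \<open>(i, j)\<close> with \<open>j \<ge> 0\<close>.  Distinct film sites are at
  distance at least 1, with equality exactly for the six differences \<open>\<plusminus>(1, 0)\<close>, \<open>\<plusminus>(0, 1)\<close>,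
  \<open>\<plusminus>(-1, 1)\<close>, and since \<open>p\<close> and \<open>q\<close> are coprime the contact sites are the \<open>(i, 0)\<close> with
  \<open>q dvd i\<close>.  So the energy of a configuration is \<open>- 2 c\<^sub>F b - c\<^sub>S m\<close>, where \<open>b\<close> is its number of
  bonds and \<open>m\<close> its number of contact atoms (\<open>energy_sites\<close>), and everything reduces to counting
  bonds in finite subsets of the half plane \<open>j \<ge> 0\<close>.  Each bond is charged to its endpoint in
  direction \<open>(1, 0)\<close>, \<open>(0, 1)\<close> or \<open>(-1, 1)\<close>, so that an atom normally pays for at most 3 bonds.

  Sufficiency.  Let \<open>k \<ge> 1\<close> be the number of atoms off the contact sites.  If \<open>q \<ge> 2\<close>, a wetting
  configuration has no bonds, and moving \<open>k\<close> atoms off the contact sites costs \<open>c\<^sub>S k\<close> and creates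
  fewer than \<open>3 k\<close> bonds, worth \<open>2 c\<^sub>F\<close> each (\<open>bonds_less_sparse_contacts\<close>); hence the threshold
  \<open>6 c\<^sub>F\<close>.  If \<open>q = 1\<close>, a consecutive chain already has \<open>n - 1\<close> bonds, while with
  \<open>k\<close> atoms off the contact sites there are at most \<open>n - 2 + 2 k\<close> (\<open>bonds_le_full_contacts\<close>);
  the gain is fewer than \<open>2 k\<close> bonds, hence the threshold \<open>4 c\<^sub>F\<close>.  Among the configurations on
  the bottom row only the consecutive ones have \<open>n - 1\<close> bonds (\<open>consecutive_if_bonds\<close>).

  Necessity.  Blocks of \<open>n\<close> atoms filled row by row, with rows of fixed length \<open>L\<close>, have
  \<open>3 n - O(L) - O(n / L)\<close> bonds (\<open>bonds_block\<close>).  Below the threshold, a large fixed \<open>L\<close> makes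
  their energy per atom smaller than that of the wetting configurations, so the latter fail to be
  minimal for all large \<open>n\<close>, and in particular along every increasing sequence.
\<close>

section \<open>Film sites in lattice coordinates\<close>

definition site :: "real \<Rightarrow> int \<times> int \<Rightarrow> point" where
  "site e a = (of_int (fst a) + of_int (snd a) / 2, e + of_int (snd a) * (sqrt 3 / 2))"

definition half_plane :: "(int \<times> int) set" where
  "half_plane = {a. snd a \<ge> 0}"

definition contact_index :: "nat \<Rightarrow> (int \<times> int) set" where
  "contact_index q = {a. snd a = 0 \<and> int q dvd fst a}"

definition unit_steps :: "(int \<times> int) set" where
  "unit_steps = {(1,0), (0,1), (-1,1), (-1,0), (0,-1), (1,-1)}"

lemma site_eq:
  "site e (i, j) = film_origin e + of_int i *\<^sub>R t1 + of_int j *\<^sub>R t2"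
  by (simp add: site_def film_origin_def t1_def t2_def)

lemma site_add_t1: "site e a + t1 = site e (a + (1, 0))"
  by (simp add: site_def t1_def)

lemma inj_site: "inj (site e)"
  by (auto simp: inj_def site_def prod_eq_iff)

lemma film_lattice_eq: "film_lattice e = site e ` half_plane"
proof (intro subset_antisym subsetI)
  fix x assume "x \<in> film_lattice e"
  then obtain i :: int and j :: nat
    where "x = film_origin e + of_int i *\<^sub>R t1 + of_nat j *\<^sub>R t2"
    unfolding film_lattice_def by blast
  then have "x = site e (i, int j)" by (simp add: site_eq)
  then show "x \<in> site e ` half_plane" by (auto simp: half_plane_def)
next
  fix x assume "x \<in> site e ` half_plane"
  then obtain i j where "x = site e (i, j)" "j \<ge> 0" by (auto simp: half_plane_def)
  then have "x = film_origin e + of_int i *\<^sub>R t1 + of_nat (nat j) *\<^sub>R t2"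
    by (simp add: site_eq)
  then show "x \<in> film_lattice e" unfolding film_lattice_def by blast
qed

lemma configurations_eq:
  "configurations e n = {site e ` A | A. A \<subseteq> half_plane \<and> finite A \<and> card A = n}"
proof (intro subset_antisym subsetI)
  fix D assume "D \<in> configurations e n"
  then have D: "D \<subseteq> site e ` half_plane" "finite D" "card D = n"
    by (auto simp: configurations_def film_lattice_eq)
  then obtain A where A: "A \<subseteq> half_plane" "D = site e ` A" by (meson subset_image_iff)
  have "inj_on (site e) A" using inj_site by (rule inj_on_subset) simp
  then have "finite A" "card A = n" using D A by (auto simp: finite_image_iff card_image)
  then show "D \<in> {site e ` A | A. A \<subseteq> half_plane \<and> finite A \<and> card A = n}" using A by blast
next
  fix D assume "D \<in> {site e ` A | A. A \<subseteq> half_plane \<and> finite A \<and> card A = n}"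
  then obtain A where A: "D = site e ` A" "A \<subseteq> half_plane" "finite A" "card A = n" by blast
  have "inj_on (site e) A" using inj_site by (rule inj_on_subset) simp
  then show "D \<in> configurations e n"
    using A by (auto simp: configurations_def film_lattice_eq card_image)
qed

lemma norm_site_diff:
  "norm (site e (i, j) - site e (k, l)) =
     sqrt (of_int ((k - i)\<^sup>2 + (k - i) * (l - j) + (l - j)\<^sup>2))"
proof -
  define u v where "u = real_of_int k - real_of_int i" and "v = real_of_int l - real_of_int j"
  have "site e (i, j) - site e (k, l) = - (u + v / 2, v * (sqrt 3 / 2))"
    by (simp add: site_def u_def v_def field_simps)
  then have "norm (site e (i, j) - site e (k, l)) = sqrt ((u + v / 2)\<^sup>2 + (v * (sqrt 3 / 2))\<^sup>2)"
    by (simp only: norm_minus_cancel norm_Pair real_norm_def power2_abs)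
  also have "(u + v / 2)\<^sup>2 + (v * (sqrt 3 / 2))\<^sup>2 = u\<^sup>2 + u * v + v\<^sup>2"
    by (simp add: power2_eq_square field_simps)
  finally show ?thesis by (simp add: u_def v_def)
qed

text \<open>
  The form \<open>x\<^sup>2 + x y + y\<^sup>2\<close> is the squared length of \<open>x t\<^sub>1 + y t\<^sub>2\<close>.
\<close>
lemma lattice_form_pos:
  fixes x y :: int
  assumes "(x, y) \<noteq> 0"
  shows "x\<^sup>2 + x * y + y\<^sup>2 \<ge> 1"
proof -
  have "2 * (x\<^sup>2 + x * y + y\<^sup>2) = x\<^sup>2 + y\<^sup>2 + (x + y)\<^sup>2" by algebra
  moreover have "x\<^sup>2 + y\<^sup>2 > 0" using assms by (auto simp: zero_prod_def sum_power2_gt_zero_iff)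
  moreover have "(x + y)\<^sup>2 \<ge> 0" by simp
  ultimately have "2 * (x\<^sup>2 + x * y + y\<^sup>2) > 0" by linarith
  then show ?thesis by simp
qed

lemma lattice_form_eq_1_iff:
  fixes x y :: int
  shows "x\<^sup>2 + x * y + y\<^sup>2 = 1 \<longleftrightarrow> (x, y) \<in> unit_steps"
proof
  assume eq: "x\<^sup>2 + x * y + y\<^sup>2 = 1"
  have bound: "\<bar>b\<bar> \<le> 1" if "a\<^sup>2 + a * b + b\<^sup>2 = 1" for a b :: int
  proof (rule ccontr)
    assume "\<not> \<bar>b\<bar> \<le> 1"
    then have "2\<^sup>2 \<le> \<bar>b\<bar>\<^sup>2" by (intro power_mono) auto
    moreover have "(2 * a + b)\<^sup>2 + 3 * b\<^sup>2 = 4" using that by algebra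
    ultimately show False using zero_le_power2[of "2 * a + b"] by simp
  qed
  have "\<bar>y\<bar> \<le> 1" using bound eq by blast
  moreover have "\<bar>x\<bar> \<le> 1" using bound[of y x] eq by (simp add: algebra_simps)
  ultimately have "x \<in> {-1, 0, 1}" "y \<in> {-1, 0, 1}" by auto
  then show "(x, y) \<in> unit_steps" using eq by (auto simp: unit_steps_def)
qed (auto simp: unit_steps_def)

lemma film_interaction:
  assumes "a \<noteq> b"
  shows "sticky_disc 1 c (norm (site e a - site e b)) =
           ereal (if b - a \<in> unit_steps then - c else 0)"
proof -
  obtain i j k l where ab: "a = (i, j)" "b = (k, l)" by (metis surj_pair)
  define N where "N = (k - i)\<^sup>2 + (k - i) * (l - j) + (l - j)\<^sup>2"
  have "(k - i, l - j) \<noteq> 0" using assms ab by (auto simp: zero_prod_def)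
  then have "N \<ge> 1" unfolding N_def by (rule lattice_form_pos)
  then have "sticky_disc 1 c (sqrt (of_int N)) = ereal (if N = 1 then - c else 0)"
    by (auto simp: sticky_disc_def zero_ereal_def)
  moreover have "N = 1 \<longleftrightarrow> b - a \<in> unit_steps"
    unfolding N_def lattice_form_eq_1_iff by (simp add: ab)
  ultimately show ?thesis by (simp add: ab norm_site_diff N_def)
qed

section \<open>Contact sites and the substrate potential\<close>

text \<open>Coprimality enters here: the integers among the multiples of \<open>q / p\<close> are the multiples of \<open>q\<close>.\<close>
lemma int_multiple_iff_dvd:
  fixes i :: int
  assumes "p \<ge> 1" "coprime p q"
  shows "(\<exists>k :: int. of_int i = of_int k * (real q / real p)) \<longleftrightarrow> int q dvd i"
proof
  assume "\<exists>k :: int. of_int i = of_int k * (real q / real p)"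
  then obtain k :: int where "of_int i = of_int k * (real q / real p)" ..
  then have "of_int i * real p = of_int k * real q" using assms by (simp add: field_simps)
  then have "of_int (i * int p) = (of_int (k * int q) :: real)" by simp
  then have "i * int p = k * int q" by (simp only: of_int_eq_iff)
  then have "int q dvd i * int p" by simp
  then show "int q dvd i"
    using assms(2) by (simp add: coprime_commute coprime_dvd_mult_left_iff)
next
  assume "int q dvd i"
  then obtain m where "i = int q * m" ..
  then have "of_int i = of_int (m * int p) * (real q / real p)" using assms by simp
  then show "\<exists>k :: int. of_int i = of_int k * (real q / real p)" by blast
qed

lemma substrate_boundary_iff:
  assumes "p \<ge> 1" "coprime p q" "e = real q / real p" "substrate_lattice e LS"
  shows "(of_int i, 0) \<in> LS \<longleftrightarrow> int q dvd i"
proof -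
  have "(of_int i, 0) \<in> LS \<longleftrightarrow> (of_int i, 0) \<in> substrate_boundary LS"
    by (simp add: substrate_boundary_def)
  also have "\<dots> \<longleftrightarrow> (\<exists>k :: int. of_int i = of_int k * e)"
    using assms(4) by (auto simp: substrate_lattice_def)
  finally show ?thesis using int_multiple_iff_dvd assms by simp
qed

lemma site_in_contact_sites_iff:
  assumes "p \<ge> 1" "coprime p q" "e = real q / real p" "substrate_lattice e LS"
  shows "site e a \<in> contact_sites e LS \<longleftrightarrow> a \<in> contact_index q"
proof -
  obtain i j where a: "a = (i, j)" by (metis surj_pair)
  have film: "film_boundary e = {(of_int k, e) | k. True}"
    by (simp add: film_boundary_def film_origin_def t1_def)
  have "site e a \<in> film_boundary e \<longleftrightarrow> j = 0" by (auto simp: film a site_def)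
  moreover have "site e (i, 0) \<in> (\<lambda>s. s + e *\<^sub>R t3) ` substrate_boundary LS
      \<longleftrightarrow> (of_int i, 0) \<in> LS"
    by (force simp: site_def t3_def substrate_boundary_def image_iff)
  ultimately show ?thesis
    using substrate_boundary_iff[OF assms, of i] by (auto simp: contact_sites_def contact_index_def a)
qed

text \<open>
  The substrate lies in the closed lower half plane and the film at height at least \<open>e\<close>, so only
  a substrate atom vertically below a bottom film site can be as close as \<open>e\<close>.
\<close>
lemma substrate_potential_site:
  assumes "p \<ge> 1" "q \<ge> 1" "coprime p q" "e = real q / real p" "substrate_lattice e LS"
    and a: "a \<in> half_plane"
  shows "substrate_potential e c LS (site e a) = ereal (if a \<in> contact_index q then - c else 0)"
proof -
  obtain i j where ij: "a = (i, j)" "j \<ge> 0" using a by (cases a) (auto simp: half_plane_def)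
  have e: "e > 0" using assms by simp
  define x0 where "x0 = (real_of_int i, 0 :: real)"
  have below: "snd s \<le> 0" if "s \<in> LS" for s
  proof -
    have "closure substrate_half_plane \<subseteq> UNIV \<times> {..0}"
      by (rule closure_minimal) (auto simp: substrate_half_plane_def closed_Times)
    then show ?thesis using that assms(5) by (force simp: substrate_lattice_def)
  qed
  have interaction: "sticky_disc e c (norm (site e a - s)) = (if j = 0 \<and> s = x0 then ereal (- c) else 0)"
    if s: "s \<in> LS" for s
  proof -
    define h where "h = of_int j * (sqrt 3 / 2) - snd s"
    define w where "w = of_int i + of_int j / 2 - fst s"
    have "of_int j * (sqrt 3 / 2) \<ge> 0" using ij by simp
    then have h: "h \<ge> 0" using below[OF s] unfolding h_def by linarith
    have "site e a - s = (w, e + h)"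
      by (simp add: prod_eq_iff ij site_def h_def w_def)
    then have n: "norm (site e a - s) = sqrt (w\<^sup>2 + (e + h)\<^sup>2)" by (simp add: norm_Pair)
    have "e \<le> e + h" using h by simp
    also have "e + h = sqrt ((e + h)\<^sup>2)" using e h by simp
    also have "\<dots> \<le> sqrt (w\<^sup>2 + (e + h)\<^sup>2)" by simp
    finally have ge: "norm (site e a - s) \<ge> e" unfolding n .
    have "norm (site e a - s) = e \<longleftrightarrow> w = 0 \<and> h = 0"
    proof
      assume "norm (site e a - s) = e"
      then have "w\<^sup>2 + (e + h)\<^sup>2 = e\<^sup>2" unfolding n using e by (metis real_sqrt_pow2 add_nonneg_nonneg zero_le_power2)
      then have "w\<^sup>2 + 2 * e * h + h\<^sup>2 = 0" by (simp add: power2_sum)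
      moreover have "2 * e * h \<ge> 0" using e h by simp
      ultimately have "w\<^sup>2 = 0" "h\<^sup>2 = 0" using zero_le_power2[of w] zero_le_power2[of h] by linarith+
      then show "w = 0 \<and> h = 0" by simp
    qed (use e n in simp)
    also have "\<dots> \<longleftrightarrow> j = 0 \<and> s = x0"
    proof
      assume wh: "w = 0 \<and> h = 0"
      then have "of_int j * (sqrt 3 / 2) \<le> 0" using below[OF s] by (simp add: h_def)
      then have "j = 0" using ij by (simp add: mult_le_0_iff)
      then show "j = 0 \<and> s = x0" using wh by (simp add: w_def h_def x0_def prod_eq_iff)
    qed (simp add: w_def h_def x0_def)
    finally show ?thesis using ge by (auto simp: sticky_disc_def)
  qed
  have "substrate_potential e c LS (site e a) =
      (\<Sum>\<^sub>\<infinity>s\<in>LS. if j = 0 \<and> s = x0 then ereal (- c) else 0)"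
    unfolding substrate_potential_def by (rule infsum_cong) (rule interaction)
  also have "\<dots> = (\<Sum>\<^sub>\<infinity>s\<in>LS \<inter> {x0}. if j = 0 then ereal (- c) else 0)"
    by (rule infsum_cong_neutral) auto
  also have "\<dots> = (if x0 \<in> LS \<and> j = 0 then ereal (- c) else 0)" by simp
  also have "x0 \<in> LS \<and> j = 0 \<longleftrightarrow> a \<in> contact_index q"
    using substrate_boundary_iff[OF assms(1,3,4,5), of i] by (auto simp: x0_def contact_index_def ij)
  finally show ?thesis by (simp add: zero_ereal_def)
qed

section \<open>The energy as a count of bonds and contacts\<close>

definition followers :: "int \<times> int \<Rightarrow> (int \<times> int) set \<Rightarrow> (int \<times> int) set" where
  "followers d A = {a \<in> A. a - d \<in> A}"

text \<open>
  Each unordered pair of bonded atoms is counted once, at its endpoint in one of the three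
  directions that represent the unit steps up to sign.
\<close>
definition bonds :: "(int \<times> int) set \<Rightarrow> nat" where
  "bonds A = card (followers (1, 0) A) + card (followers (0, 1) A) + card (followers (-1, 1) A)"

lemma followers_subset: "followers d A \<subseteq> A"
  by (auto simp: followers_def)

lemma card_followers_uminus: "card (followers (- d) A) = card (followers d A)"
proof (rule bij_betw_same_card)
  show "bij_betw (\<lambda>a. a + d) (followers (- d) A) (followers d A)"
    by (rule bij_betw_byWitness[where f' = "\<lambda>a. a - d"]) (auto simp: followers_def)
qed

lemma card_bonded_pairs:
  assumes "finite A"
  shows "card {(a, b). a \<in> A \<and> b \<in> A \<and> b - a \<in> unit_steps} = 2 * bonds A"
proof -
  let ?P = "\<lambda>d. {(a, b). a \<in> A \<and> b \<in> A \<and> b - a = d}"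
  have eq: "{(a, b). a \<in> A \<and> b \<in> A \<and> b - a \<in> unit_steps} = (\<Union>d\<in>unit_steps. ?P d)" by auto
  have fin: "finite (?P d)" for d by (rule finite_subset[of _ "A \<times> A"]) (use assms in auto)
  have card: "card (?P d) = card (followers d A)" for d
  proof (rule bij_betw_same_card)
    show "bij_betw snd (?P d) (followers d A)"
      by (rule bij_betw_byWitness[where f' = "\<lambda>b. (b - d, b)"]) (auto simp: followers_def)
  qed
  have "card (\<Union>d\<in>unit_steps. ?P d) = (\<Sum>d\<in>unit_steps. card (?P d))"
    by (rule card_UN_disjoint) (use fin in \<open>auto simp: unit_steps_def\<close>)
  also have "\<dots> = (\<Sum>d\<in>unit_steps. card (followers d A))" by (simp only: card)
  also have "\<dots> = 2 * bonds A"
    using card_followers_uminus[of "(1, 0)" A] card_followers_uminus[of "(0, 1)" A]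
      card_followers_uminus[of "(-1, 1)" A]
    by (simp add: unit_steps_def bonds_def)
  finally show ?thesis by (simp add: eq)
qed

lemma energy_sites:
  assumes "p \<ge> 1" "q \<ge> 1" "coprime p q" "e = real q / real p" "substrate_lattice e LS"
    and A: "A \<subseteq> half_plane" "finite A"
  shows "energy e cF cS LS (site e ` A) =
           ereal (- (2 * cF * bonds A) - cS * card (A \<inter> contact_index q))"
proof -
  have inj: "inj_on (site e) A" using inj_site by (rule inj_on_subset) simp
  let ?Q = "{(a, b). a \<in> A \<and> b \<in> A \<and> a \<noteq> b}"
  let ?B = "{(a, b). a \<in> A \<and> b \<in> A \<and> b - a \<in> unit_steps}"
  have finQ: "finite ?Q" by (rule finite_subset[of _ "A \<times> A"]) (use A in auto)
  have B: "?B = ?Q \<inter> {(a, b). b - a \<in> unit_steps}"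
    by (auto simp: unit_steps_def zero_prod_def)
  have "bij_betw (map_prod (site e) (site e)) ?Q
      {(x, y). x \<in> site e ` A \<and> y \<in> site e ` A \<and> x \<noteq> y}"
    by (rule bij_betw_byWitness[where f' = "map_prod (inv (site e)) (inv (site e))"])
      (auto simp: inv_f_f[OF inj_site] inj_eq[OF inj_site], (metis prod.inject)+)
  then have "(\<Sum>(x, y) \<in> {(x, y). x \<in> site e ` A \<and> y \<in> site e ` A \<and> x \<noteq> y}.
                sticky_disc 1 cF (norm (x - y)))
      = (\<Sum>(a, b)\<in>?Q. sticky_disc 1 cF (norm (site e a - site e b)))"
    by (subst sum.reindex_bij_betw[symmetric]) (auto simp: case_prod_unfold)
  also have "\<dots> = (\<Sum>(a, b)\<in>?Q. ereal (if b - a \<in> unit_steps then - cF else 0))"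
    by (intro sum.cong refl) (simp add: case_prod_beta film_interaction)
  also have "\<dots> = ereal (\<Sum>(a, b)\<in>?Q. if b - a \<in> unit_steps then - cF else 0)"
    by (simp add: case_prod_unfold)
  also have "(\<Sum>(a, b)\<in>?Q. if b - a \<in> unit_steps then - cF else 0) = (\<Sum>z\<in>?B. - cF)"
    unfolding B sum.inter_restrict[OF finQ] by (intro sum.cong) auto
  also have "\<dots> = - (2 * cF * bonds A)" using card_bonded_pairs[OF A(2)] by simp
  finally have film: "(\<Sum>(x, y) \<in> {(x, y). x \<in> site e ` A \<and> y \<in> site e ` A \<and> x \<noteq> y}.
      sticky_disc 1 cF (norm (x - y))) = ereal (- (2 * cF * bonds A))" .
  have "(\<Sum>x\<in>site e ` A. substrate_potential e cS LS x)
      = (\<Sum>a\<in>A. ereal (if a \<in> contact_index q then - cS else 0))"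
    unfolding sum.reindex[OF inj]
    using substrate_potential_site[OF assms(1-5)] A by (intro sum.cong) auto
  also have "\<dots> = ereal (\<Sum>a\<in>A. if a \<in> contact_index q then - cS else 0)" by simp
  also have "(\<Sum>a\<in>A. if a \<in> contact_index q then - cS else 0) = (\<Sum>a\<in>A \<inter> contact_index q. - cS)"
    by (rule sum.inter_restrict[OF A(2), symmetric])
  finally show ?thesis unfolding energy_def film by simp
qed

section \<open>Upper bounds on the number of bonds\<close>

text \<open>
  The functional \<open>(i, j) \<mapsto> i + 2 j\<close> is positive on the three chosen directions, so an atom that
  minimises it has no bonds charged to it.
\<close>
lemma exists_extremal:
  assumes "finite A" "A \<noteq> {}"
  shows "\<exists>a\<in>A. a \<notin> followers (1, 0) A \<and> a \<notin> followers (0, 1) A \<and> a \<notin> followers (-1, 1) A"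
proof -
  let ?f = "\<lambda>a :: int \<times> int. fst a + 2 * snd a"
  obtain a where a: "a \<in> A" "\<And>b. b \<in> A \<Longrightarrow> ?f a \<le> ?f b"
    using arg_min_if_finite(1)[OF assms, of ?f] arg_min_least[OF assms, of _ ?f] by blast
  have "a - d \<notin> A" if "?f d > 0" for d using a(2)[of "a - d"] that by auto
  then show ?thesis using a(1) by (intro bexI[of _ a]) (auto simp: followers_def)
qed

lemma card_followers_less:
  assumes "finite A" "a \<in> A" "a \<notin> followers d A"
  shows "card (followers d A) < card A"
  by (rule psubset_card_mono) (use assms followers_subset[of d A] in auto)

lemma card_horizontal_less:
  assumes "finite A" "A \<noteq> {}"
  shows "card (followers (1, 0) A) < card A"
proof -
  obtain a where "a \<in> A" "a \<notin> followers (1, 0) A" using exists_extremal[OF assms] by blast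
  then show ?thesis by (rule card_followers_less[OF assms(1)])
qed

lemma bonds_le_interior:
  assumes "finite A" "A \<noteq> {}"
  shows "bonds A + 3 \<le> 3 * card A"
proof -
  obtain a where a: "a \<in> A" "a \<notin> followers (1, 0) A" "a \<notin> followers (0, 1) A"
      "a \<notin> followers (-1, 1) A"
    using exists_extremal[OF assms] by blast
  note less = card_followers_less[OF assms(1) a(1)]
  from less[OF a(2)] less[OF a(3)] less[OF a(4)] show ?thesis by (simp add: bonds_def)
qed

text \<open>
  Horizontal bonds do not connect different rows, and slanted bonds are charged to their upper
  endpoint, which is never in the bottom row.
\<close>
lemma bonds_split_bottom_row:
  assumes "A \<subseteq> half_plane" "finite A"
  defines "R \<equiv> {a \<in> A. snd a = 0}" and "U \<equiv> {a \<in> A. snd a \<noteq> 0}"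
  shows "bonds A \<le> card (followers (1, 0) R) + card (followers (1, 0) U) + 2 * card U"
proof -
  have fin: "finite R" "finite U" using assms by (auto simp: R_def U_def)
  have "followers (1, 0) A = followers (1, 0) R \<union> followers (1, 0) U"
    by (auto simp: followers_def R_def U_def)
  then have "card (followers (1, 0) A) \<le> card (followers (1, 0) R) + card (followers (1, 0) U)"
    by (simp add: card_Un_le)
  moreover have "followers (0, 1) A \<subseteq> U" "followers (-1, 1) A \<subseteq> U"
    using assms(1) by (auto simp: followers_def U_def half_plane_def)
  then have "card (followers (0, 1) A) \<le> card U" "card (followers (-1, 1) A) \<le> card U"
    using fin by (auto intro: card_mono)
  ultimately show ?thesis by (simp add: bonds_def)
qed

text \<open>
  Neighbouring contact sites are at distance \<open>q \<ge> 2\<close>, so each bond has an endpoint off the contact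
  sites and can be charged to it.  A bottom atom then pays for its at most two horizontal bonds, and
  an upper atom for three, except for the first upper atom, which has nobody to its left.
\<close>
lemma bonds_less_sparse_contacts:
  assumes "A \<subseteq> half_plane" "finite A" "q \<ge> 2" "A - contact_index q \<noteq> {}"
  shows "bonds A < 3 * card (A - contact_index q)"
proof -
  define R where "R = {a \<in> A. snd a = 0}"
  define U where "U = {a \<in> A. snd a \<noteq> 0}"
  define N where "N = R - contact_index q"
  have fin: "finite R" "finite U" "finite N" using assms(2) by (auto simp: R_def U_def N_def)
  have "A - contact_index q = N \<union> U" by (auto simp: N_def R_def U_def contact_index_def)
  moreover have "N \<inter> U = {}" by (auto simp: N_def R_def U_def)
  ultimately have split: "card (A - contact_index q) = card N + card U" "N \<noteq> {} \<or> U \<noteq> {}"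
    using fin assms(4) by (auto simp: card_Un_disjoint)
  have "followers (1, 0) R \<subseteq> N \<union> (\<lambda>a. a + (1, 0)) ` N"
  proof
    fix a assume "a \<in> followers (1, 0) R"
    then have a: "a \<in> R" "a - (1, 0) \<in> R" by (auto simp: followers_def)
    have "\<not> (int q dvd fst a \<and> int q dvd fst a - 1)"
    proof
      assume "int q dvd fst a \<and> int q dvd fst a - 1"
      then have "int q dvd fst a - (fst a - 1)" by (blast intro: dvd_diff)
      then show False using assms(3) by simp
    qed
    then have "a \<in> N \<or> a - (1, 0) \<in> N" using a by (auto simp: N_def contact_index_def)
    then show "a \<in> N \<union> (\<lambda>a. a + (1, 0)) ` N" by (metis UnCI diff_add_cancel image_eqI)
  qed
  then have "card (followers (1, 0) R) \<le> card (N \<union> (\<lambda>a. a + (1, 0)) ` N)"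
    using fin by (intro card_mono) auto
  also have "\<dots> \<le> card N + card N"
    using card_Un_le[of N] card_image_le[OF fin(3)] by (meson add_left_mono le_trans)
  finally have row: "card (followers (1, 0) R) \<le> 2 * card N" by simp
  have "card (followers (1, 0) U) \<le> card U" by (rule card_mono[OF fin(2) followers_subset])
  moreover have "card (followers (1, 0) U) < card U" if "U \<noteq> {}"
    using card_horizontal_less fin that by blast
  moreover have "card N > 0" if "U = {}" using split(2) that fin by (simp add: card_gt_0_iff)
  moreover have "bonds A \<le> card (followers (1, 0) R) + card (followers (1, 0) U) + 2 * card U"
    using bonds_split_bottom_row[OF assms(1,2)] by (simp add: R_def U_def)
  ultimately show ?thesis unfolding split(1) using row by (cases "U = {}") auto
qed

text \<open>
  Both the bottom row and the upper part lose one horizontal bond.  If the bottom row is empty,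
  the bound for the whole triangular lattice applies instead.
\<close>
lemma bonds_le_full_contacts:
  assumes "A \<subseteq> half_plane" "finite A" "A - contact_index 1 \<noteq> {}"
  shows "bonds A + 2 \<le> card A + 2 * card (A - contact_index 1)"
proof -
  define R where "R = {a \<in> A. snd a = 0}"
  define U where "U = {a \<in> A. snd a \<noteq> 0}"
  have U: "A - contact_index 1 = U" by (auto simp: U_def contact_index_def)
  have fin: "finite R" "finite U" using assms(2) by (auto simp: R_def U_def)
  have "A = R \<union> U" "R \<inter> U = {}" by (auto simp: R_def U_def)
  then have card: "card A = card R + card U" using fin by (simp add: card_Un_disjoint)
  show ?thesis
  proof (cases "R = {}")
    case True
    then have "bonds A + 3 \<le> 3 * card U" using bonds_le_interior[OF assms(2)] assms(3) card by auto
    then show ?thesis unfolding U card by simp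
  next
    case False
    then have "card (followers (1, 0) R) < card R" "card (followers (1, 0) U) < card U"
      using card_horizontal_less fin assms(3) U by blast+
    moreover have "bonds A \<le> card (followers (1, 0) R) + card (followers (1, 0) U) + 2 * card U"
      using bonds_split_bottom_row[OF assms(1,2)] by (simp add: R_def U_def)
    ultimately show ?thesis unfolding U card by simp
  qed
qed

section \<open>Configurations on the contact sites\<close>

lemma bonds_bottom_row:
  assumes "A \<subseteq> contact_index q"
  shows "bonds A = card (followers (1, 0) A)"
proof -
  have row: "snd a = 0" if "a \<in> A" for a using that assms by (auto simp: contact_index_def)
  have "followers d A = {}" if "snd d \<noteq> 0" for d
  proof (rule ccontr)
    assume "followers d A \<noteq> {}"
    then obtain a where "a \<in> A" "a - d \<in> A" unfolding followers_def by blast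
    then show False using row[of a] row[of "a - d"] that by simp
  qed
  then show ?thesis by (simp add: bonds_def)
qed

lemma bonds_sparse_contacts:
  assumes "A \<subseteq> contact_index q" "q \<ge> 2"
  shows "bonds A = 0"
proof -
  have "followers (1, 0) A = {}"
  proof (rule ccontr)
    assume "followers (1, 0) A \<noteq> {}"
    then obtain a where "a \<in> contact_index q" "a - (1, 0) \<in> contact_index q"
      using assms(1) unfolding followers_def by blast
    then have "int q dvd fst a" "int q dvd fst a - 1" by (auto simp: contact_index_def)
    then have "int q dvd fst a - (fst a - 1)" by (blast intro: dvd_diff)
    then show False using assms(2) by simp
  qed
  then show ?thesis using bonds_bottom_row[OF assms(1)] by simp
qed

lemma bonds_consecutive:
  assumes "consecutive n (site e ` A)" "A \<subseteq> contact_index q" "finite A" "card A = n" "n \<ge> 1"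
  shows "bonds A + 1 = n"
proof -
  obtain w where w: "bij_betw w {1..n} (site e ` A)" "\<And>i. i \<in> {1..<n} \<Longrightarrow> w (i + 1) = w i + t1"
    using assms(1) by (auto simp: consecutive_def)
  have "w ` (Suc ` {1..<n}) \<subseteq> site e ` followers (1, 0) A"
  proof
    fix x assume "x \<in> w ` (Suc ` {1..<n})"
    then obtain i where i: "i \<in> {1..<n}" "x = w (i + 1)"
      by (auto simp: image_image simp del: image_Suc_atLeastLessThan)
    have "w i \<in> site e ` A" "w (i + 1) \<in> site e ` A"
      using w(1) i by (auto simp: bij_betw_def)
    then obtain a b where ab: "a \<in> A" "w i = site e a" "b \<in> A" "w (i + 1) = site e b" by blast
    then have "site e b = site e (a + (1, 0))" using w(2)[OF i(1)] by (simp add: site_add_t1)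
    then have "b = a + (1, 0)" using inj_site by (metis injD)
    then have "b \<in> followers (1, 0) A" using ab by (simp add: followers_def)
    then show "x \<in> site e ` followers (1, 0) A" using ab i by simp
  qed
  then have "card (w ` (Suc ` {1..<n})) \<le> card (site e ` followers (1, 0) A)"
    using assms(3) finite_subset[OF followers_subset] by (intro card_mono) auto
  also have "\<dots> \<le> card (followers (1, 0) A)"
    using assms(3) finite_subset[OF followers_subset] by (intro card_image_le) auto
  also have "card (w ` (Suc ` {1..<n})) = n - 1"
  proof -
    have "inj_on w (Suc ` {1..<n})"
      using w(1) by (auto simp: bij_betw_def intro: inj_on_subset)
    then show ?thesis by (simp add: card_image)
  qed
  finally have "n - 1 \<le> bonds A" using bonds_bottom_row[OF assms(2)] by simp
  moreover have "bonds A < n"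
    using card_horizontal_less[of A] assms bonds_bottom_row[OF assms(2)] by fastforce
  ultimately show ?thesis by simp
qed

text \<open>
  With \<open>n - 1\<close> bonds, only the leftmost atom lacks a left neighbour, so that the row has no gaps.
\<close>
lemma consecutive_if_bonds:
  assumes "A \<subseteq> contact_index q" "finite A" "card A = n" "n \<ge> 1" "bonds A + 1 \<ge> n"
  shows "consecutive n (site e ` A)"
proof -
  have ne: "A \<noteq> {}" using assms by auto
  have row: "snd a = 0" if "a \<in> A" for a using that assms(1) by (auto simp: contact_index_def)
  define l where "l = Min (fst ` A)"
  define r where "r = Max (fst ` A)"
  have l: "(l, 0) \<in> A"
  proof -
    have "l \<in> fst ` A" unfolding l_def using assms(2) ne by (intro Min_in) auto
    then show ?thesis using row by (force simp: prod_eq_iff)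
  qed
  have r: "(r, 0) \<in> A"
  proof -
    have "r \<in> fst ` A" unfolding r_def using assms(2) ne by (intro Max_in) auto
    then show ?thesis using row by (force simp: prod_eq_iff)
  qed
  have bounds: "l \<le> fst a \<and> fst a \<le> r" if "a \<in> A" for a
    using that assms(2) by (simp add: l_def r_def)
  have lnot: "(l, 0) \<notin> followers (1, 0) A" using bounds by (force simp: followers_def)
  have sub: "followers (1, 0) A \<subseteq> A - {(l, 0)}" using lnot followers_subset by blast
  have "card (A - {(l, 0)}) \<le> card (followers (1, 0) A)"
    using assms l bonds_bottom_row[OF assms(1)] by simp
  then have eq: "followers (1, 0) A = A - {(l, 0)}"
    using sub assms(2) by (meson card_seteq finite_Diff)
  have fill: "(r - int k, 0) \<in> A" if "int k \<le> r - l" for k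
    using that
  proof (induction k)
    case (Suc k)
    then have "(r - int k, 0) \<in> A - {(l, 0)}" by auto
    then have "(r - int k, 0) - (1, 0) \<in> A" unfolding eq[symmetric] by (simp add: followers_def)
    then show ?case by (simp add: algebra_simps)
  qed (use r in simp)
  have A: "A = (\<lambda>i. (i, 0)) ` {l..r}"
  proof (intro subset_antisym subsetI)
    fix a assume "a \<in> A"
    then show "a \<in> (\<lambda>i. (i, 0)) ` {l..r}" using bounds[of a] row[of a]
      by (intro image_eqI[of _ _ "fst a"]) (auto simp: prod_eq_iff)
  next
    fix a assume "a \<in> (\<lambda>i. (i, 0 :: int)) ` {l..r}"
    then obtain i where i: "a = (i, 0)" "l \<le> i" "i \<le> r" by auto
    then show "a \<in> A" using fill[of "nat (r - i)"] by simp
  qed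
  have "card A = card {l..r}" unfolding A by (rule card_image) (simp add: inj_on_def)
  then have n: "int n = r - l + 1" using assms(3,4) by simp
  define w where "w = (\<lambda>i :: nat. site e (l + int i - 1, 0))"
  have "w ` {1..n} = site e ` A"
  proof -
    have "(\<lambda>i :: nat. l + int i - 1) ` {1..n} = {l..r}"
    proof (intro subset_antisym subsetI)
      fix i assume "i \<in> {l..r}"
      then show "i \<in> (\<lambda>i :: nat. l + int i - 1) ` {1..n}"
        using n by (intro image_eqI[of _ _ "nat (i - l + 1)"]) auto
    qed (use n in auto)
    then show ?thesis unfolding A w_def by (metis (no_types, lifting) image_image image_cong)
  qed
  moreover have "inj_on w {1..n}" by (auto simp: w_def inj_on_def inj_eq[OF inj_site])
  ultimately have "bij_betw w {1..n} (site e ` A)" by (simp add: bij_betw_def)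
  moreover have "w (i + 1) = w i + t1" for i by (simp add: w_def site_add_t1)
  ultimately show ?thesis unfolding consecutive_def by blast
qed

section \<open>Blocks with many bonds\<close>

text \<open>The first \<open>n\<close> sites when rows of length \<open>L\<close> are filled from left to right and upwards.\<close>
definition block :: "nat \<Rightarrow> nat \<Rightarrow> (int \<times> int) set" where
  "block L n = {(x, y). 0 \<le> x \<and> x < int L \<and> 0 \<le> y \<and> x + int L * y < int n}"

lemma bij_betw_block:
  assumes "L \<ge> 1"
  shows "bij_betw (\<lambda>i. (int (i mod L), int (i div L))) {..<n} (block L n)"
proof (rule bij_betw_byWitness[where f' = "\<lambda>(x, y). nat (x + int L * y)"])
  have recompose: "int (i mod L) + int L * int (i div L) = int i" for i
    by (metis add.commute mult.commute div_mult_mod_eq of_nat_add of_nat_mult)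
  show "\<forall>i\<in>{..<n}. (case (int (i mod L), int (i div L)) of (x, y) \<Rightarrow> nat (x + int L * y)) = i"
    by (simp add: recompose)
  show "(\<lambda>i. (int (i mod L), int (i div L))) ` {..<n} \<subseteq> block L n"
    using assms by (auto simp: block_def recompose)
  show "\<forall>a\<in>block L n. (int ((case a of (x, y) \<Rightarrow> nat (x + int L * y)) mod L),
      int ((case a of (x, y) \<Rightarrow> nat (x + int L * y)) div L)) = a"
    by (auto simp: block_def zmod_int zdiv_int)
  show "(\<lambda>(x, y). nat (x + int L * y)) ` block L n \<subseteq> {..<n}"
    by (auto simp: block_def nat_less_iff)
qed

lemma
  assumes "L \<ge> 1"
  shows finite_block: "finite (block L n)" and card_block: "card (block L n) = n"
proof -
  note bij = bij_betw_block[OF assms, of n]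
  show "finite (block L n)" using bij_betw_finite[OF bij] by simp
  show "card (block L n) = n" using bij_betw_same_card[OF bij] by simp
qed

lemma block_subset_half_plane: "block L n \<subseteq> half_plane"
  by (auto simp: block_def half_plane_def)

text \<open>
  Only atoms in the bottom row or in the first or last column can lack a predecessor: there are
  at most \<open>L\<close> of the former, and each column has at most \<open>n div L + 1\<close> atoms.
\<close>
lemma bonds_block:
  assumes "L \<ge> 1"
  shows "3 * n \<le> bonds (block L n) + 2 * L + 2 * (n div L + 1)"
proof -
  define A where "A = block L n"
  define H where "H = {0..int (n div L)}"
  have finA: "finite A" and cardA: "card A = n"
    using finite_block card_block assms by (auto simp: A_def)
  have height: "y \<in> H" if "(x, y) \<in> A" for x y
  proof -
    have "int L * y \<le> int n" "0 \<le> y" using that by (auto simp: A_def block_def)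
    then have "int L * y div int L \<le> int n div int L" using assms by (intro zdiv_mono1) auto
    then have "y \<le> int n div int L" using assms by simp
    then show ?thesis using \<open>0 \<le> y\<close> by (simp add: H_def zdiv_int)
  qed
  have defect: "n \<le> card (followers d A) + card T" if "finite T" "A - followers d A \<subseteq> T" for d T
  proof -
    have "card (A - followers d A) \<le> card T" using that by (intro card_mono) auto
    moreover have "card (A - followers d A) = n - card (followers d A)"
      using cardA followers_subset finA by (metis card_Diff_subset finite_subset)
    ultimately show ?thesis by simp
  qed
  have cH: "card ({x} \<times> H) = n div L + 1" for x :: int
    by (simp add: H_def card_cartesian_product)
  have cL: "card ({0..<int L} \<times> {0 :: int}) = L" by (simp add: card_cartesian_product)
  have "A - followers (1, 0) A \<subseteq> {0} \<times> H"
    using height by (auto simp: followers_def) (auto simp: A_def block_def)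
  then have 1: "n \<le> card (followers (1, 0) A) + (n div L + 1)"
    using defect[of "{0} \<times> H"] cH by (simp add: H_def)
  have "A - followers (0, 1) A \<subseteq> {0..<int L} \<times> {0}"
    using assms by (auto simp: followers_def A_def block_def algebra_simps)
  then have 2: "n \<le> card (followers (0, 1) A) + L"
    using defect[of "{0..<int L} \<times> {0}"] cL by simp
  have "A - followers (-1, 1) A \<subseteq> {0..<int L} \<times> {0} \<union> {int L - 1} \<times> H"
    using height by (auto simp: followers_def) (auto simp: A_def block_def algebra_simps)
  then have "n \<le> card (followers (-1, 1) A) + card ({0..<int L} \<times> {0} \<union> {int L - 1} \<times> H)"
    by (intro defect) (auto simp: H_def)
  also have "card ({0..<int L} \<times> {0} \<union> {int L - 1} \<times> H) \<le> L + (n div L + 1)"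
    using card_Un_le[of "{0..<int L} \<times> {0}" "{int L - 1} \<times> H"] cH cL by simp
  finally have 3: "n \<le> card (followers (-1, 1) A) + (L + (n div L + 1))" by simp
  from 1 2 3 show ?thesis unfolding bonds_def A_def by simp
qed

text \<open>
  Energies below \<open>- g n\<close> are reached for all large \<open>n\<close> as soon as \<open>g < 6 c\<close>, since in a bulk
  configuration each atom contributes 3 bonds of weight \<open>2 c\<close>.
\<close>
lemma bulk_bonds_dominate:
  fixes c g :: real
  assumes "c > 0" "g < 6 * c"
  obtains L n0 where "L \<ge> 1" "\<And>n. n \<ge> n0 \<Longrightarrow> g * n < 2 * c * bonds (block L n)"
proof -
  define \<delta> where "\<delta> = 6 * c - g"
  have \<delta>: "\<delta> > 0" using assms by (simp add: \<delta>_def)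
  \<comment> \<open>Rows of this length lose at most \<open>\<delta> / 2\<close> per atom at their ends.\<close>
  obtain L :: nat where "8 * c / \<delta> < real L" using reals_Archimedean2 by blast
  then have L: "8 * c < \<delta> * L" using \<delta> by (simp add: field_simps)
  then have L1: "L \<ge> 1" using assms(1) by (cases L) auto
  obtain n0 :: nat where "(8 * c * L + 8 * c) / \<delta> < real n0" using reals_Archimedean2 by blast
  then have n0: "8 * c * L + 8 * c < \<delta> * n0" using \<delta> by (simp add: field_simps)
  have "g * n < 2 * c * bonds (block L n)" if "n \<ge> n0" for n
  proof -
    have "\<delta> * n0 \<le> \<delta> * n" using that \<delta> by simp
    then have n: "8 * c * L + 8 * c < \<delta> * n" using n0 by linarith
    have "real (3 * n) \<le> real (bonds (block L n) + 2 * L + 2 * (n div L + 1))"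
      using bonds_block[OF L1, of n] by (simp only: of_nat_le_iff)
    then have "3 * real n \<le> bonds (block L n) + 2 * real L + 2 * real (n div L) + 2" by simp
    then have "2 * c * (3 * real n) \<le> 2 * c * (bonds (block L n) + 2 * real L + 2 * real (n div L) + 2)"
      using assms(1) by (intro mult_left_mono) auto
    then have b: "6 * c * n \<le> 2 * c * bonds (block L n) + 4 * c * L + 4 * c * (n div L) + 4 * c"
      by (simp add: algebra_simps)
    have "8 * c * (n div L) \<le> \<delta> * L * (n div L)"
      using L by (intro mult_right_mono) auto
    also have "\<dots> = \<delta> * real (L * (n div L))" by simp
    also have "\<dots> \<le> \<delta> * n" using \<delta> by (intro mult_left_mono) (auto simp del: of_nat_mult)
    finally have "8 * c * (n div L) \<le> \<delta> * n" .
    with n have "4 * c * L + 4 * c * (n div L) + 4 * c < \<delta> * n" by linarith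
    with b show ?thesis by (simp add: \<delta>_def algebra_simps)
  qed
  then show ?thesis using that L1 by blast
qed

section \<open>Wetting configurations and the threshold\<close>

definition wetting_energy :: "nat \<Rightarrow> real \<Rightarrow> real \<Rightarrow> nat \<Rightarrow> real" where
  "wetting_energy q cF cS n = - (if q = 1 then 2 * cF * (real n - 1) else 0) - cS * real n"

context
  fixes cF cS e :: real and p q :: nat and LS :: "point set"
  assumes cF: "cF > 0" and cS: "cS > 0"
    and pq: "p \<ge> 1" "q \<ge> 1" "coprime p q" "e = real q / real p"
    and LS: "substrate_lattice e LS"
begin

lemma sites_subset_contact_sites_iff:
  "site e ` A \<subseteq> contact_sites e LS \<longleftrightarrow> A \<subseteq> contact_index q"
  using site_in_contact_sites_iff[OF pq(1,3,4) LS] by auto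

lemma energy_wetting:
  assumes "wetting_configuration q e LS n D" "n \<ge> 1"
  shows "D \<in> configurations e n" "energy e cF cS LS D = ereal (wetting_energy q cF cS n)"
proof -
  have D: "D \<subseteq> contact_sites e LS" "finite D" "card D = n" "q = 1 \<Longrightarrow> consecutive n D"
    using assms(1) by (auto simp: wetting_configuration_def)
  have "film_boundary e \<subseteq> film_lattice e"
    by (force simp: film_boundary_def film_lattice_def intro: exI[of _ 0])
  then have "D \<subseteq> film_lattice e" using D(1) by (auto simp: contact_sites_def)
  then show conf: "D \<in> configurations e n" using D by (simp add: configurations_def)
  then obtain A where A: "D = site e ` A" "A \<subseteq> half_plane" "finite A" "card A = n"
    unfolding configurations_eq by blast
  have sub: "A \<subseteq> contact_index q" using D(1) A(1) sites_subset_contact_sites_iff by simp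
  then have inter: "A \<inter> contact_index q = A" by blast
  have "2 * cF * bonds A = (if q = 1 then 2 * cF * (real n - 1) else 0)"
  proof (cases "q = 1")
    case True
    then have "bonds A + 1 = n" using bonds_consecutive[OF _ sub A(3,4) assms(2)] D(4) A(1) by simp
    then show ?thesis using True by auto
  next
    case False
    then show ?thesis using bonds_sparse_contacts[OF sub] pq(2) by simp
  qed
  then show "energy e cF cS LS D = ereal (wetting_energy q cF cS n)"
    using energy_sites[OF pq LS A(2,3)] A(1,4) by (simp add: inter wetting_energy_def)
qed

text \<open>
  At the threshold, the contact energy lost by atoms that leave the contact sites already outweighs
  the bonds that they gain, because the bond counts are strict.  On the contact sites, only a chain
  with a gap, which has lost a bond, can fail to be a wetting configuration.
\<close>
lemma energy_greater_if_threshold: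
  assumes thr: "wetting_threshold q cF cS" and n: "n \<ge> 1"
    and E: "E \<in> configurations e n" "\<not> wetting_configuration q e LS n E"
  shows "ereal (wetting_energy q cF cS n) < energy e cF cS LS E"
proof -
  obtain A where A: "E = site e ` A" "A \<subseteq> half_plane" "finite A" "card A = n"
    using E(1) unfolding configurations_eq by blast
  define m where "m = card (A \<inter> contact_index q)"
  define k where "k = card (A - contact_index q)"
  have nmk: "n = m + k" using card_Int_Diff[OF A(3)] A(4) by (simp add: m_def k_def)
  have fincard: "finite E" "card E = n" using E(1) by (auto simp: configurations_def)
  have "2 * cF * bonds A + cS * m < - wetting_energy q cF cS n"
  proof (cases "A \<subseteq> contact_index q")
    case True
    then have k: "k = 0" by (simp add: k_def Diff_eq_empty_iff[THEN iffD2])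
    have "E \<subseteq> contact_sites e LS" using True A(1) sites_subset_contact_sites_iff by simp
    then have q: "q = 1" "\<not> consecutive n E"
      using E(2) fincard by (auto simp: wetting_configuration_def)
    have "\<not> n \<le> bonds A + 1" using consecutive_if_bonds[OF True A(3,4) n] q A(1) by blast
    then have "real (bonds A) < real n - 1" by linarith
    then have "2 * cF * bonds A < 2 * cF * (real n - 1)" using cF by simp
    then show ?thesis using q k nmk by (simp add: wetting_energy_def)
  next
    case False
    then have ne: "A - contact_index q \<noteq> {}" by blast
    show ?thesis
    proof (cases "q = 1")
      case True
      have "bonds A + 2 \<le> n + 2 * k"
        using bonds_le_full_contacts[OF A(2,3)] ne True A(4) by (simp add: k_def)
      then have "real (bonds A) < real n - 1 + 2 * k" by linarith
      then have "2 * cF * bonds A < 2 * cF * (real n - 1 + 2 * k)" using cF by simp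
      moreover have "4 * cF * k \<le> cS * k"
        using thr True by (intro mult_right_mono) (auto simp: wetting_threshold_def)
      ultimately show ?thesis using True nmk by (simp add: wetting_energy_def algebra_simps)
    next
      case False
      have "bonds A < 3 * k"
        using bonds_less_sparse_contacts[OF A(2,3) _ ne] False pq(2) by (simp add: k_def)
      then have "real (bonds A) < 3 * k" by linarith
      then have "2 * cF * bonds A < 2 * cF * (3 * k)" using cF by simp
      moreover have "6 * cF * k \<le> cS * k"
        using thr False by (intro mult_right_mono) (auto simp: wetting_threshold_def)
      ultimately show ?thesis using False nmk by (simp add: wetting_energy_def algebra_simps)
    qed
  qed
  then show ?thesis using energy_sites[OF pq LS A(2,3)] A(1) by (simp add: m_def)
qed

lemma minimizes_and_beats_if_threshold:
  assumes "wetting_threshold q cF cS" "n \<ge> 1" and D: "wetting_configuration q e LS n D"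
  shows "minimizes_energy e cF cS LS n D" "strictly_beats_nonwetting q e cF cS LS n D"
proof -
  note eD = energy_wetting[OF D assms(2)]
  have strict: "energy e cF cS LS D < energy e cF cS LS E"
    if "E \<in> configurations e n" "\<not> wetting_configuration q e LS n E" for E
    using energy_greater_if_threshold[OF assms(1,2) that] eD(2) by simp
  have equal: "energy e cF cS LS E = energy e cF cS LS D" if "wetting_configuration q e LS n E" for E
    using energy_wetting[OF that assms(2)] eD(2) by simp
  show "minimizes_energy e cF cS LS n D"
    unfolding minimizes_energy_def is_arg_min_def using eD(1) strict equal
    by (metis less_asym less_irrefl)
  show "strictly_beats_nonwetting q e cF cS LS n D"
    unfolding strictly_beats_nonwetting_def
    by (auto intro!: strict simp: wetting_configuration_def)
qed

text \<open>
  Blocks are competitors for every number of atoms, so a single large \<open>n\<close> with a minimal wetting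
  configuration contradicts parameters below the threshold.  How large depends on the parameters,
  which is why minimality is required for arbitrarily large \<open>n\<close>.
\<close>
lemma threshold_if_minimizes_frequently:
  assumes min: "\<And>N. \<exists>n\<ge>N. \<exists>D. wetting_configuration q e LS n D \<and> minimizes_energy e cF cS LS n D"
  shows "wetting_threshold q cF cS"
proof (rule ccontr)
  assume below: "\<not> wetting_threshold q cF cS"
  \<comment> \<open>\<open>- g\<close> bounds the energy per atom of a wetting configuration from below.\<close>
  define g where "g = (if q = 1 then 2 * cF + cS else cS)"
  have "g < 6 * cF" using below by (auto simp: g_def wetting_threshold_def split: if_splits)
  then obtain L n0 where L: "L \<ge> 1"
    and big: "\<And>n. n \<ge> n0 \<Longrightarrow> g * n < 2 * cF * bonds (block L n)"
    using bulk_bonds_dominate[OF cF] by blast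
  obtain n D where n: "n \<ge> max 1 n0" and D: "wetting_configuration q e LS n D"
    and m: "minimizes_energy e cF cS LS n D"
    using min by blast
  let ?A = "block L n"
  have "site e ` ?A \<in> configurations e n"
    unfolding configurations_eq using block_subset_half_plane finite_block[OF L] card_block[OF L] by blast
  then have "\<not> energy e cF cS LS (site e ` ?A) < energy e cF cS LS D"
    using m by (simp add: minimizes_energy_def is_arg_min_def)
  moreover have "energy e cF cS LS D = ereal (wetting_energy q cF cS n)"
    using energy_wetting[OF D] n by simp
  moreover have "energy e cF cS LS (site e ` ?A) =
      ereal (- (2 * cF * bonds ?A) - cS * card (?A \<inter> contact_index q))"
    by (rule energy_sites[OF pq LS block_subset_half_plane finite_block[OF L]])
  moreover have "- (g * n) \<le> wetting_energy q cF cS n"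
    using cF by (auto simp: wetting_energy_def g_def algebra_simps)
  moreover have "g * n < 2 * cF * bonds ?A" using big n by simp
  moreover have "cS * card (?A \<inter> contact_index q) \<ge> 0" using cS by simp
  ultimately show False by simp
qed

end

theorem theorem2p2:
  fixes cF cS eS :: real and p q :: nat and LS :: "point set" and Dw :: "nat \<Rightarrow> point set"
  assumes "cF > 0" and "cS > 0"
    and "p \<ge> 1" and "q \<ge> 1" and "coprime p q"
    and "eS = real q / real p"
    and "substrate_lattice eS LS"
    and "\<forall>n\<ge>1. wetting_configuration q eS LS n (Dw n)"
  shows "((\<forall>n\<ge>1. minimizes_energy eS cF cS LS n (Dw n) \<and>
                  strictly_beats_nonwetting q eS cF cS LS n (Dw n))
            \<longleftrightarrow> wetting_threshold q cF cS)
    \<and> ((\<forall>n\<ge>1. minimizes_energy eS cF cS LS n (Dw n)) \<longrightarrow> wetting_threshold q cF cS)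
    \<and> ((\<exists>\<nu> :: nat \<Rightarrow> nat. strict_mono \<nu> \<and> (\<forall>k. \<nu> k \<ge> 1) \<and>
          (\<forall>k. minimizes_energy eS cF cS LS (\<nu> k) (Dw (\<nu> k))))
        \<longrightarrow> wetting_threshold q cF cS)"
proof -
  note wet = assms(8)
  have suff: "minimizes_energy eS cF cS LS n (Dw n) \<and>
      strictly_beats_nonwetting q eS cF cS LS n (Dw n)"
    if "wetting_threshold q cF cS" "n \<ge> 1" for n
    using minimizes_and_beats_if_threshold[OF assms(1-7) that] wet that(2) by blast
  have sub: "wetting_threshold q cF cS"
    if \<nu>: "strict_mono \<nu>" "\<And>k. \<nu> k \<ge> 1" "\<And>k. minimizes_energy eS cF cS LS (\<nu> k) (Dw (\<nu> k))"
    for \<nu> :: "nat \<Rightarrow> nat"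
  proof (rule threshold_if_minimizes_frequently[OF assms(1-7)])
    fix N
    show "\<exists>n\<ge>N. \<exists>D. wetting_configuration q eS LS n D \<and> minimizes_energy eS cF cS LS n D"
      using strict_mono_imp_increasing[OF \<nu>(1), of N] \<nu>(2,3) wet by blast
  qed
  have all: "wetting_threshold q cF cS" if "\<forall>n\<ge>1. minimizes_energy eS cF cS LS n (Dw n)"
    by (rule sub[of Suc]) (use that in \<open>auto simp: strict_mono_Suc_iff\<close>)
  show ?thesis using suff sub all by blast
qed

end
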